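(* Let $\mathbf{D}_{prior}\in\mathbb{C}^{N\times N}$ satisfy $\mathbf{D}_{prior}^H\mathbf{D}_{prior}=\mathbf{I}$, let $j\in\{1,\dots,N\}$, and let $\mathbf{r}\in\mathbb{C}^{N\times 1}$ be arbitrary. Put $\mathbf{w}=\mathbf{D}_{prior}^H\mathbf{r}$ and let $\alpha\in\mathbb{C}$ be a scalar with $|\alpha|=\|\mathbf{r}\|_2$ and $\alpha\,\mathbf{w}^H\mathbf{e}_j\in\mathbb{R}$. Consider the optimization problem over $\mathbf{D}_{post}\in\mathbb{C}^{N\times N}$ $$\min_{\mathbf{D}_{post}}\ \operatorname{rank}(\mathbf{D}_{post}-\mathbf{D}_{prior})\quad\text{subject to}\quad \mathbf{D}_{post}^H\mathbf{r}=\alpha\mathbf{e}_j,\qquad \mathbf{D}_{post}^H\mathbf{D}_{post}=\mathbf{I}.$$ Then the global optimal solution of this problem is as follows. (a) If $\mathbf{r}=\alpha\mathbf{D}_{prior,j}$, then $\mathbf{D}_{post}=\mathbf{D}_{prior}$. (b) If $\mathbf{r}\neq\alpha\mathbf{D}_{prior,j}$, then $$\mathbf{D}_{post}=\mathbf{D}_{prior}-\frac{2}{\|\mathbf{w}-\alpha\mathbf{e}_j\|_2^2}\,(\mathbf{r}-\alpha\mathbf{D}_{prior,j})(\mathbf{w}-\alpha\mathbf{e}_j)^H.$$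
   Context: $(\cdot)^H$ denotes conjugate transpose, $\mathbf{e}_j$ is the $j$-th standard basis vector of $\mathbb{C}^N$, and $\mathbf{D}_{prior,j}$ is the $j$-th column of $\mathbf{D}_{prior}$. $\mathbf{D}_{prior}$ is called the prior transform domain (assumed orthogonal, i.e. unitary), $\mathbf{D}_{post}$ the posterior transform domain, and $\mathbf{r}$ the reference knowledge. *)

theory Defs
  imports "HOL-Analysis.Analysis"
begin

definition conj_transpose :: "complex^'n^'m \<Rightarrow> complex^'m^'n"
  where "conj_transpose A = (\<chi> i j. cnj (A $ j $ i))"

(* the scalar u^H v: conjugate-linear in the first argument *)
definition herm_prod :: "complex^'n \<Rightarrow> complex^'n \<Rightarrow> complex"
  where "herm_prod u v = (\<Sum>i\<in>UNIV. cnj (u $ i) * v $ i)"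

(* the rank-one matrix u v^H *)
definition outer_prod :: "complex^'m \<Rightarrow> complex^'n \<Rightarrow> complex^'n^'m"
  where "outer_prod u v = (\<chi> i k. u $ i * cnj (v $ k))"

definition feasible :: "complex^'n \<Rightarrow> complex \<Rightarrow> 'n \<Rightarrow> complex^'n^'n \<Rightarrow> bool"
  where "feasible r \<alpha> j X \<longleftrightarrow>
    conj_transpose X *v r = \<alpha> *s axis j 1 \<and> conj_transpose X ** X = mat 1"

(* The rank is the library's rank over the field of complex numbers
   (dimension of the complex span of the rows). *)
definition global_opt ::
    "complex^'n^'n \<Rightarrow> complex^'n \<Rightarrow> complex \<Rightarrow> 'n \<Rightarrow> complex^'n^'n \<Rightarrow> bool"
  where "global_opt D r \<alpha> j = is_arg_min (\<lambda>X. rank (X - D)) (feasible r \<alpha> j)"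

end

theory Submission
  imports Defs
begin

text \<open>
  Multiplying by the unitary matrix \<open>D = D_prior\<close> on the left turns the problem into one about
  \<open>M = D\<^sup>H D_post\<close>: find the unitary \<open>M\<close> closest in rank to the identity whose adjoint sends
  \<open>w = D\<^sup>H r\<close> to \<open>\<alpha> e\<^sub>j\<close>. These two vectors have the same norm, because \<open>|\<alpha>| = \<parallel>r\<parallel>\<close>, and a real inner
  product, by the choice of the phase of \<open>\<alpha>\<close>. Hence the complex Householder reflection along
  \<open>v = w - \<alpha> e\<^sub>j\<close> carries one to the other, and it differs from the identity by a matrix of rank one. This
  gives a feasible point of rank one. Rank zero would mean \<open>D_post = D\<close>, which is feasible exactly
  when \<open>v = 0\<close>, that is, when \<open>r = \<alpha> D e\<^sub>j\<close>.

  What remains is uniqueness among the feasible points with \<open>rank (D_post - D) = 1\<close>. Such a point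
  is \<open>X = D + p q\<^sup>H\<close>. The constraint \<open>X\<^sup>H r = \<alpha> e\<^sub>j\<close> says that a multiple of \<open>q\<close> is \<open>-v\<close>, so
  one may take \<open>q = v\<close>. Since \<open>X\<close> is unitary, the constraint also says \<open>X (\<alpha> e\<^sub>j) = r = D w\<close>, so
  \<open>X v = X w - D w = (v\<^sup>H w) p\<close>. On the other hand \<open>X v = D v + (v\<^sup>H v) p\<close>. As
  \<open>v\<^sup>H w = v\<^sup>H v / 2\<close>, comparing the two determines \<open>p\<close>, and \<open>X\<close> is the Householder solution.
  The existence half is \<open>householder_unitary\<close> and \<open>householder_maps\<close>; the uniqueness half is
  \<open>unitary_rank_one_update_unique\<close>.
\<close>

section \<open>Hermitian products, adjoints and rank-one matrices\<close>

lemma herm_prod_diff_right: "herm_prod u (x - y) = herm_prod u x - herm_prod u y"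
  by (simp add: herm_prod_def algebra_simps sum_subtractf)

lemma herm_prod_diff_left: "herm_prod (x - y) u = herm_prod x u - herm_prod y u"
  by (simp add: herm_prod_def algebra_simps sum_subtractf)

lemma herm_prod_scale_right: "herm_prod u (c *s x) = c * herm_prod u x"
  by (simp add: herm_prod_def algebra_simps sum_distrib_left)

lemma cnj_herm_prod: "cnj (herm_prod u x) = herm_prod x u"
  by (simp add: herm_prod_def mult.commute)

lemma herm_prod_self: "herm_prod x x = of_real ((norm x)\<^sup>2)"
proof -
  have "(norm x)\<^sup>2 = (\<Sum>i\<in>UNIV. (cmod (x $ i))\<^sup>2)"
    by (simp add: norm_vec_def L2_set_def sum_nonneg)
  then show ?thesis
    by (simp add: herm_prod_def complex_norm_square[symmetric] mult.commute[of "cnj _"])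
qed

lemma conj_transpose_mult:
  "conj_transpose (A ** B) = conj_transpose B ** conj_transpose A"
  by (simp add: conj_transpose_def matrix_matrix_mult_def vec_eq_iff mult.commute)

lemma conj_transpose_add: "conj_transpose (A + B) = conj_transpose A + conj_transpose B"
  by (simp add: conj_transpose_def vec_eq_iff)

lemma conj_transpose_outer_prod: "conj_transpose (outer_prod u v) = outer_prod v u"
  by (simp add: conj_transpose_def outer_prod_def vec_eq_iff mult.commute)

lemma herm_prod_adjoint: "herm_prod (A *v x) y = herm_prod x (conj_transpose A *v y)"
proof -
  have "herm_prod (A *v x) y = (\<Sum>i\<in>UNIV. \<Sum>k\<in>UNIV. cnj (A $ i $ k) * cnj (x $ k) * y $ i)"
    by (simp add: herm_prod_def matrix_vector_mult_def sum_distrib_right)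
  also have "\<dots> = (\<Sum>k\<in>UNIV. \<Sum>i\<in>UNIV. cnj (A $ i $ k) * cnj (x $ k) * y $ i)"
    by (rule sum.swap)
  also have "\<dots> = herm_prod x (conj_transpose A *v y)"
    by (simp add: herm_prod_def matrix_vector_mult_def conj_transpose_def
        sum_distrib_left algebra_simps)
  finally show ?thesis .
qed

lemma outer_prod_mult_vec: "outer_prod u v *v x = herm_prod v x *s u"
  by (simp add: outer_prod_def herm_prod_def matrix_vector_mult_def vec_eq_iff
      sum_distrib_right sum_distrib_left algebra_simps)

lemma outer_prod_scale_right: "outer_prod u (c *s v) = outer_prod (cnj c *s u) v"
  by (simp add: outer_prod_def vec_eq_iff)

lemma scaleR_outer_prod: "c *\<^sub>R outer_prod u v = outer_prod (of_real c *s u) v"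
  by (simp add: outer_prod_def vec_eq_iff scaleR_conv_of_real[where 'a=complex])

lemma outer_prod_minus_left: "outer_prod (- u) v = - outer_prod u v"
  by (simp add: outer_prod_def vec_eq_iff)

lemma norm_unitary_mult:
  assumes "conj_transpose D ** D = mat 1"
  shows "norm (D *v x) = norm x"
proof -
  have "herm_prod (D *v x) (D *v x) = herm_prod x x"
    by (simp add: herm_prod_adjoint matrix_vector_mul_assoc assms)
  then have "(norm (D *v x))\<^sup>2 = (norm x)\<^sup>2"
    unfolding herm_prod_self of_real_eq_iff .
  then show ?thesis by simp
qed

lemma rank_eq_0_iff:
  fixes A :: "complex^'n^'m"
  shows "rank A = 0 \<longleftrightarrow> A = 0"
proof -
  have "rank A = 0 \<longleftrightarrow> rows A \<subseteq> {0}"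
    by (simp add: row_rank_def_gen vec.dim_eq_0)
  also have "\<dots> \<longleftrightarrow> (\<forall>i. row i A = 0)"
    by (auto simp: rows_def)
  also have "\<dots> \<longleftrightarrow> A = 0"
    by (simp add: row_def vec_eq_iff)
  finally show ?thesis .
qed

lemma rank_outer_prod_le: "rank (outer_prod u v) \<le> 1"
proof -
  have "rows (outer_prod u v) \<subseteq> vec.span {\<chi> k. cnj (v $ k)}"
  proof
    fix y assume "y \<in> rows (outer_prod u v)"
    then obtain i where "y = u $ i *s (\<chi> k. cnj (v $ k))"
      by (auto simp: rows_def row_def outer_prod_def vec_eq_iff)
    then show "y \<in> vec.span {\<chi> k. cnj (v $ k)}"
      by (simp add: vec.span_base vec.span_scale)
  qed
  then have "vec.dim (rows (outer_prod u v)) \<le> card {\<chi> k. cnj (v $ k)}"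
    by (rule vec.dim_le_card) simp
  then show ?thesis by (simp add: row_rank_def_gen)
qed

lemma rank_le_1_imp_outer_prod:
  fixes A :: "complex^'n^'m"
  assumes "rank A \<le> 1"
  obtains p q where "A = outer_prod p q"
proof -
  obtain B where B: "B \<subseteq> rows A" "vec.independent B" "rows A \<subseteq> vec.span B"
    "card B = vec.dim (rows A)"
    using vec.basis_exists by blast
  have "finite B" using B(2) by (rule vec.finiteI_independent)
  moreover have "card B \<le> 1" using assms B(4) by (simp add: row_rank_def_gen)
  ultimately obtain b where "B \<subseteq> {b}"
    by (metis One_nat_def card_le_Suc0_iff_eq insertI1 subsetI singletonD)
  then have "rows A \<subseteq> vec.span {b}"
    using B(3) vec.span_mono by blast
  then have "\<forall>i. \<exists>c. row i A = c *s b"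
    by (auto simp: rows_def vec.span_singleton)
  then obtain c where c: "\<And>i. row i A = c i *s b" by metis
  have "A = outer_prod (\<chi> i. c i) (\<chi> k. cnj (b $ k))"
    using c by (simp add: outer_prod_def row_def vec_eq_iff)
  then show ?thesis by (rule that)
qed

section \<open>Householder reflections\<close>

definition householder :: "complex^'n \<Rightarrow> complex^'n^'n"
  where "householder v = mat 1 - (2 / (norm v)\<^sup>2) *\<^sub>R outer_prod v v"

lemma householder_mult_vec:
  "householder v *v x = x - (2 / of_real ((norm v)\<^sup>2) * herm_prod v x) *s v"
  by (simp add: householder_def matrix_vector_mult_diff_rdistrib scaleR_outer_prod
      outer_prod_mult_vec vec_eq_iff)

lemma mult_householder:
  "D ** householder v = D - (2 / (norm v)\<^sup>2) *\<^sub>R outer_prod (D *v v) v"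
  by (simp add: matrix_eq matrix_vector_mul_assoc[symmetric] householder_mult_vec
      matrix_vector_mult_diff_distrib matrix_vector_mult_diff_rdistrib scaleR_outer_prod
      outer_prod_mult_vec vector_scalar_commute mult.commute)

lemma conj_transpose_householder: "conj_transpose (householder v) = householder v"
  by (simp add: householder_def conj_transpose_def outer_prod_def mat_def vec_eq_iff
      scaleR_conv_of_real[where 'a=complex])

lemma householder_unitary:
  assumes "v \<noteq> 0"
  shows "conj_transpose (householder v) ** householder v = mat 1"
proof -
  have nz: "complex_of_real (norm v) \<noteq> 0" using assms by simp
  have "householder v *v (householder v *v x) = x" for x
    using nz by (simp add: householder_mult_vec herm_prod_diff_right herm_prod_scale_right
        herm_prod_self vec_eq_iff field_simps)
  then show ?thesis
    by (simp add: matrix_eq conj_transpose_householder matrix_vector_mul_assoc[symmetric])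
qed

text \<open>
  Over the reals equal norms make \<open>w\<close> and \<open>a\<close> mirror images in the hyperplane orthogonal to
  \<open>w - a\<close>. Over the complex numbers \<open>(w - a)\<^sup>H w\<close> and \<open>(w - a)\<^sup>H (w - a) / 2\<close> still have the same
  real part, but the imaginary part of the former is that of \<open>-a\<^sup>H w\<close>, which has to vanish.
\<close>

lemma herm_prod_diff_half:
  assumes "norm a = norm w" and "herm_prod w a \<in> \<real>"
  shows "herm_prod (w - a) w = of_real ((norm (w - a))\<^sup>2) / 2"
proof -
  have "herm_prod a w = herm_prod w a"
    using assms(2) by (metis Reals_cnj_iff cnj_herm_prod)
  then have "herm_prod (w - a) (w - a) = 2 * herm_prod (w - a) w"
    by (simp add: herm_prod_diff_left herm_prod_diff_right) (simp add: herm_prod_self assms(1))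
  then show ?thesis
    by (simp add: herm_prod_self)
qed

lemma householder_maps:
  assumes "norm a = norm w" and "herm_prod w a \<in> \<real>"
  shows "householder (w - a) *v w = a"
proof (cases "w = a")
  case False
  then have "complex_of_real (norm (w - a)) \<noteq> 0" by simp
  then show ?thesis
    by (simp add: householder_mult_vec herm_prod_diff_half[OF assms])
qed (simp add: householder_mult_vec)

section \<open>Unitary matrices that differ by rank one\<close>

text \<open>
  The constraint \<open>X\<^sup>H r = a\<close> fixes the row direction \<open>q\<close> of the update; evaluating \<open>X\<close> at
  \<open>v = D\<^sup>H r - a\<close> in two ways fixes the column \<open>p\<close>.
\<close>

lemma unitary_rank_one_update_unique:
  fixes D X :: "complex^'n^'n"
  assumes D: "conj_transpose D ** D = mat 1"
    and X: "conj_transpose X ** X = mat 1"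
    and Xr: "conj_transpose X *v r = a"
    and v: "v = conj_transpose D *v r - a" "v \<noteq> 0"
    and real: "herm_prod (conj_transpose D *v r) a \<in> \<real>"
    and rank: "rank (X - D) \<le> 1"
  shows "X = D - (2 / (norm v)\<^sup>2) *\<^sub>R outer_prod (r - D *v a) v"
proof -
  define w where "w = conj_transpose D *v r"
  have Dw: "D *v w = r"
    using D by (simp add: w_def matrix_vector_mul_assoc matrix_left_right_inverse)
  \<comment> \<open>Unitarity of \<open>X\<close> turns the constraint on its adjoint into one on \<open>X\<close> itself.\<close>
  have Xa: "X *v a = r"
    using X by (simp add: Xr[symmetric] matrix_vector_mul_assoc matrix_left_right_inverse)
  have norms: "norm a = norm w"
    using norm_unitary_mult[OF D, of w] norm_unitary_mult[OF X, of a] by (simp add: Dw Xa)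
  have v': "v = w - a" using v(1) by (simp add: w_def)
  obtain p0 q where "X - D = outer_prod p0 q"
    using rank by (rule rank_le_1_imp_outer_prod)
  then have X0: "X = D + outer_prod p0 q" by (simp add: algebra_simps)
  have "a = w + herm_prod p0 r *s q"
    using Xr by (simp add: X0 conj_transpose_add conj_transpose_outer_prod
        matrix_vector_mult_add_rdistrib outer_prod_mult_vec w_def)
  then have q: "herm_prod p0 r *s q = - v" by (simp add: v' algebra_simps)
  \<comment> \<open>Only the product \<open>p0 q\<^sup>H\<close> is determined, so the scalar factor may be moved from \<open>q\<close> to \<open>p0\<close>.\<close>
  moreover have "herm_prod p0 r \<noteq> 0" using q v(2) by auto
  ultimately have "q = (- 1 / herm_prod p0 r) *s v"
    by (simp add: vec_eq_iff field_simps)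
  then obtain p where Xp: "X = D + outer_prod p v"
    using X0 outer_prod_scale_right by metis
  define n where "n = complex_of_real ((norm v)\<^sup>2)"
  have n: "n \<noteq> 0" using v(2) by (simp add: n_def)
  have vw: "herm_prod v w = n / 2"
    using herm_prod_diff_half[of a w] norms real by (simp add: v' n_def w_def)
  have "X *v v = X *v w - r"
    by (simp add: v' matrix_vector_mult_diff_distrib Xa)
  also have "\<dots> = (n / 2) *s p"
    by (simp add: Xp matrix_vector_mult_add_rdistrib Dw outer_prod_mult_vec vw)
  finally have "X *v v = (n / 2) *s p" .
  moreover have "X *v v = (r - D *v a) + n *s p"
    by (simp add: Xp matrix_vector_mult_add_rdistrib outer_prod_mult_vec herm_prod_self n_def)
      (simp add: v' matrix_vector_mult_diff_distrib Dw)
  ultimately have eq: "(r - D *v a) + n *s p = (n / 2) *s p" by simp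
  define u where "u = r - D *v a"
  have "p $ i = - (2 / n) * u $ i" for i
  proof -
    have "u $ i + n * p $ i = n / 2 * p $ i"
      using arg_cong[OF eq, of "\<lambda>x. x $ i"] by (simp add: u_def)
    then show ?thesis using n by (simp add: field_simps eq_neg_iff_add_eq_0)
  qed
  then have "p = - (of_real (2 / (norm v)\<^sup>2) *s u)"
    by (simp add: vec_eq_iff n_def)
  then show ?thesis
    by (simp add: Xp scaleR_outer_prod outer_prod_minus_left flip: u_def)
qed

section \<open>The optimal posterior transform domain\<close>

theorem theorem1:
  fixes D_prior :: "complex^'n^'n" and r w :: "complex^'n" and \<alpha> :: complex and j :: 'n
  assumes "conj_transpose D_prior ** D_prior = mat 1"
    and "w = conj_transpose D_prior *v r"
    and "cmod \<alpha> = norm r"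
    and "\<alpha> * herm_prod w (axis j 1) \<in> \<real>"
  shows "(r = \<alpha> *s column j D_prior \<longrightarrow>
            (\<forall>D_post. global_opt D_prior r \<alpha> j D_post \<longleftrightarrow> D_post = D_prior)) \<and>
         (r \<noteq> \<alpha> *s column j D_prior \<longrightarrow>
            (\<forall>D_post. global_opt D_prior r \<alpha> j D_post \<longleftrightarrow>
               D_post = D_prior - (2 / (norm (w - \<alpha> *s axis j 1))\<^sup>2) *\<^sub>R
                 outer_prod (r - \<alpha> *s column j D_prior) (w - \<alpha> *s axis j 1)))"
proof -
  define a where "a = \<alpha> *s (axis j 1 :: complex^'n)"
  define v where "v = w - a"
  define X0 where "X0 = D_prior - (2 / (norm v)\<^sup>2) *\<^sub>R outer_prod (r - D_prior *v a) v"
  note D = assms(1)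
  have Da: "\<alpha> *s column j D_prior = D_prior *v a"
    by (simp add: a_def vector_scalar_commute column_def matrix_vector_mult_def axis_def
        if_distrib vec_eq_iff cong: if_cong)
  have Dw: "D_prior *v w = r"
    using D by (simp add: assms(2) matrix_vector_mul_assoc matrix_left_right_inverse)
  have norms: "norm a = norm w"
  proof -
    have "(norm a)\<^sup>2 = (cmod \<alpha>)\<^sup>2"
    proof -
      have "herm_prod a a = \<alpha> * cnj \<alpha>"
        by (simp add: a_def herm_prod_def axis_def if_distrib cong: if_cong)
      then show ?thesis
        by (simp only: herm_prod_self complex_norm_square[symmetric] of_real_eq_iff)
    qed
    moreover have "norm w = norm r"
      using norm_unitary_mult[OF D, of w] by (simp add: Dw)
    ultimately show ?thesis using assms(3) by simp
  qed
  have real: "herm_prod w a \<in> \<real>"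
    using assms(4) by (simp add: a_def herm_prod_scale_right)
  have feasible_iff: "feasible r \<alpha> j X \<longleftrightarrow>
      conj_transpose X *v r = a \<and> conj_transpose X ** X = mat 1" for X
    by (simp add: feasible_def a_def)
  have D_feasible: "feasible r \<alpha> j D_prior \<longleftrightarrow> v = 0"
    using D by (simp add: feasible_iff assms(2)[symmetric] v_def)
  have v0: "v = 0 \<longleftrightarrow> r = D_prior *v a"
  proof
    assume "r = D_prior *v a"
    then show "v = 0"
      using D by (simp add: v_def assms(2) matrix_vector_mul_assoc)
  qed (use Dw in \<open>simp add: v_def\<close>)
  have rank_pos: "rank (X - D_prior) > 0" if "X \<noteq> D_prior" for X
    using that rank_eq_0_iff[of "X - D_prior"] by auto
  have part_a: "global_opt D_prior r \<alpha> j X \<longleftrightarrow> X = D_prior" if "v = 0" for X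
  proof -
    have "rank (D_prior - D_prior) = 0" by (simp add: rank_eq_0_iff)
    then show ?thesis
      using that D_feasible rank_pos[of X] unfolding global_opt_def is_arg_min_def
      by (metis not_less_zero)
  qed
  have part_b: "global_opt D_prior r \<alpha> j X \<longleftrightarrow> X = X0" if "v \<noteq> 0" for X
  proof -
    have X0_rank: "rank (X0 - D_prior) \<le> 1"
    proof -
      have "X0 - D_prior
          = outer_prod (- (of_real (2 / (norm v)\<^sup>2) *s (r - D_prior *v a))) v"
        by (simp only: X0_def scaleR_outer_prod outer_prod_minus_left) simp
      then show ?thesis by (metis rank_outer_prod_le)
    qed
    have X0_eq: "X0 = D_prior ** householder v"
      by (simp add: X0_def mult_householder v_def matrix_vector_mult_diff_distrib Dw)
    have "conj_transpose X0 ** X0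
        = conj_transpose (householder v) ** (conj_transpose D_prior ** D_prior) ** householder v"
      by (simp add: X0_eq conj_transpose_mult matrix_mul_assoc)
    then have "conj_transpose X0 ** X0 = mat 1"
      using D householder_unitary[OF that] by simp
    moreover have "conj_transpose X0 *v r = a"
      using householder_maps[OF norms real]
      by (simp add: X0_eq conj_transpose_mult matrix_vector_mul_assoc[symmetric]
          conj_transpose_householder assms(2)[symmetric] v_def)
    ultimately have X0_feasible: "feasible r \<alpha> j X0" by (simp add: feasible_iff)
    show ?thesis
    proof
      assume opt: "global_opt D_prior r \<alpha> j X"
      then have X: "feasible r \<alpha> j X" and "rank (X - D_prior) \<le> rank (X0 - D_prior)"
        using X0_feasible by (auto simp: global_opt_def is_arg_min_def not_less)
      then have "rank (X - D_prior) \<le> 1" using X0_rank by simp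
      then show "X = X0"
        unfolding X0_def
        using unitary_rank_one_update_unique[OF D, of X r a v] X that real
        by (simp add: feasible_iff v_def assms(2))
    next
      assume "X = X0"
      moreover have "\<not> rank (Y - D_prior) < rank (X0 - D_prior)" if "feasible r \<alpha> j Y" for Y
        using that D_feasible \<open>v \<noteq> 0\<close> rank_pos[of Y] X0_rank by fastforce
      ultimately show "global_opt D_prior r \<alpha> j X"
        using X0_feasible by (auto simp: global_opt_def is_arg_min_def)
    qed
  qed
  show ?thesis
    using part_a part_b v0 unfolding X0_def Da a_def[symmetric] v_def[symmetric] by blast
qed

end
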